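(* Let $T$ be a finite set (of rule templates) and let $\tau \in T^{\mathbb{Z}}$ be a non-recurrent rule distribution template. Then there exist a finite set $\mathcal{R}$ of local rules (with some common finite state set $\Sigma$ and common neighbourhood $N$ in $\mathbb{Z}$) and an assignment $\alpha : T \to \mathcal{R}$ such that the global update rule $H_{\tau_\alpha}:\Sigma^{\mathbb{Z}}\to\Sigma^{\mathbb{Z}}$ is surjective but not pre-injective.
   Context: A neighbourhood is a tuple $N = (n_1,\ldots,n_m)$ of integers. A local rule with finite state set $\Sigma$ and neighbourhood $N$ is a function $f:\Sigma^m \to \Sigma$. A rule distribution is $\theta \in \mathcal{R}^{\mathbb{Z}}$, where $\mathcal{R}$ is a finite set of local rules with the same state set $\Sigma$ and neighbourhood $N$. Its global update rule is $H_\theta:\Sigma^{\mathbb{Z}}\to\Sigma^{\mathbb{Z}}$, $$H_\theta(c)(x) = \theta(x)\big(c(x+n_1),\ldots,c(x+n_m)\big)\quad\text{for all } x \in \mathbb{Z}.$$ A rule distribution template is a configuration $\tau\in T^{\mathbb{Z}}$ over a finite set $T$ of rule templates (abstract symbols). An assignment of local rules is a function $\alpha:T\to\mathcal{R}$; the rule distribution $\tau_\alpha\in\mathcal{R}^{\mathbb{Z}}$ is given by $\tau_\alpha(x)=\alpha(\tau(x))$. Two configurations $c,e\in\Sigma^{\mathbb{Z}}$ are asymptotic if $\{x : c(x)\neq e(x)\}$ is finite. $H_\theta$ is pre-injective if $H_\theta(c)\neq H_\theta(e)$ for all asymptotic $c,e$ with $c \neq e$. A configuration $c$ is recurrent if every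 finite pattern that appears in it appears at least twice: for every nonempty finite $D\subseteq\mathbb{Z}$ there is $r\in\mathbb{Z}$, $r\neq 0$, such that $c(x+r)=c(x)$ for all $x\in D$. Non-recurrent means not recurrent. *)

theory Defs
  imports Complex_Main "HOL-Library.FuncSet"
begin

definition configs :: "'s set \<Rightarrow> (int \<Rightarrow> 's) set" where
  "configs S = UNIV \<rightarrow> S"

text \<open>
  Elements of \<open>S\<^sup>m\<close> are lists of length \<open>m\<close> over \<open>S\<close>. The extensional function space makes
  every map \<open>S\<^sup>m \<rightarrow> S\<close> correspond to exactly one local rule.
\<close>

definition local_rules :: "'s set \<Rightarrow> int list \<Rightarrow> ('s list \<Rightarrow> 's) set" where
  "local_rules S N = {w. set w \<subseteq> S \<and> length w = length N} \<rightarrow>\<^sub>E S"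

definition global_rule :: "int list \<Rightarrow> (int \<Rightarrow> 's list \<Rightarrow> 's) \<Rightarrow> (int \<Rightarrow> 's) \<Rightarrow> int \<Rightarrow> 's" where
  "global_rule N \<theta> c x = \<theta> x (map (\<lambda>n. c (x + n)) N)"

definition rule_distribution :: "(int \<Rightarrow> 't) \<Rightarrow> ('t \<Rightarrow> 'r) \<Rightarrow> int \<Rightarrow> 'r" where
  "rule_distribution \<tau> \<alpha> x = \<alpha> (\<tau> x)"

definition asymptotic :: "(int \<Rightarrow> 's) \<Rightarrow> (int \<Rightarrow> 's) \<Rightarrow> bool" where
  "asymptotic c e \<longleftrightarrow> finite {x. c x \<noteq> e x}"

definition pre_injective_on :: "(int \<Rightarrow> 's) set \<Rightarrow> ((int \<Rightarrow> 's) \<Rightarrow> int \<Rightarrow> 's) \<Rightarrow> bool" where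
  "pre_injective_on C H \<longleftrightarrow>
    (\<forall>c\<in>C. \<forall>e\<in>C. asymptotic c e \<longrightarrow> c \<noteq> e \<longrightarrow> H c \<noteq> H e)"

definition recurrent :: "(int \<Rightarrow> 't) \<Rightarrow> bool" where
  "recurrent c \<longleftrightarrow>
    (\<forall>D. finite D \<longrightarrow> D \<noteq> {} \<longrightarrow> (\<exists>r. r \<noteq> 0 \<and> (\<forall>x\<in>D. c (x + r) = c x)))"

end

theory Submission
  imports Defs "HOL-Library.Nat_Bijection"
begin

text \<open>
  Let \<open>d\<^sub>0, \<dots>, d\<^bsub>L-1\<^esub>\<close> enumerate a finite domain whose \<open>\<tau>\<close>-pattern appears only once. A state
  consists of bits \<open>0, \<dots>, L\<close>. Bit \<open>L\<close> follows the two-to-one rule \<open>b'(z) = b(z) + b(z+1)\<close>. For every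
  \<open>x\<close>, the bits \<open>i\<close> of the cells \<open>x + d\<^sub>i\<close> (\<open>i < L\<close>) form a cycle \<open>a\<^sub>0, \<dots>, a\<^bsub>L-1\<^esub>\<close>, updated by
  \<open>a'\<^sub>i = a\<^sub>i + a\<^bsub>i-1\<^esub>\<close> with \<open>b(x + d\<^sub>0)\<close> added for \<open>i = 0\<close>; but a cell that sees
  \<open>\<tau>(x + d\<^sub>i) \<noteq> \<tau>(d\<^sub>i)\<close> keeps \<open>a'\<^sub>i = a\<^sub>i\<close>. Every cycle with \<open>x \<noteq> 0\<close> is cut somewhere, so it is updated
  bijectively. The cycle of \<open>x = 0\<close> is intact: complementing all its bits changes nothing, so
  pre-injectivity fails. Its outputs sum to \<open>b(d\<^sub>0)\<close>, and this bit can still be prescribed, since a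
  preimage under the two-to-one rule may take either value at one given cell; so surjectivity holds.
\<close>

definition cyc_prev :: "nat \<Rightarrow> nat \<Rightarrow> nat" where
  "cyc_prev L i = (if i = 0 then L - 1 else i - 1)"

lemma cyc_prev_less: "i < L \<Longrightarrow> cyc_prev L i < L"
  by (auto simp: cyc_prev_def)

text \<open>\<open>s\<close> is the cell itself, \<open>s'\<close> its right neighbour,
  \<open>q i\<close> the bit before bit \<open>i\<close> on its cycle. The template enters only
  through \<open>ok\<close>.\<close>

definition cell_update ::
  "nat \<Rightarrow> (nat \<Rightarrow> bool) \<Rightarrow> (nat \<Rightarrow> bool) \<Rightarrow> (nat \<Rightarrow> bool) \<Rightarrow> (nat \<Rightarrow> bool) \<Rightarrow> nat \<Rightarrow> bool" where
  "cell_update L ok s s' q i =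
    (if i = L then s L \<noteq> s' L
     else if ok i then (s i \<noteq> q i) \<noteq> (i = 0 \<and> s L)
     else s i)"

definition bit_update ::
  "(int \<Rightarrow> 't) \<Rightarrow> (nat \<Rightarrow> int) \<Rightarrow> nat \<Rightarrow> (int \<Rightarrow> nat \<Rightarrow> bool) \<Rightarrow> int \<Rightarrow> nat \<Rightarrow> bool" where
  "bit_update \<tau> d L c z =
    cell_update L (\<lambda>i. \<tau> z = \<tau> (d i)) (c z) (c (z + 1))
      (\<lambda>i. c (z + (d (cyc_prev L i) - d i)) (cyc_prev L i))"

text \<open>
  The cycle is opened before index \<open>0\<close>: \<open>u\<close> stands for the sum of \<open>b\<close> and the last bit of the cycle,
  and \<open>unroll ok y u (Suc i)\<close> is the bit \<open>i\<close> that is then forced by the outputs \<open>y\<close>.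
\<close>

primrec unroll :: "(nat \<Rightarrow> bool) \<Rightarrow> (nat \<Rightarrow> bool) \<Rightarrow> bool \<Rightarrow> nat \<Rightarrow> bool" where
  "unroll ok y u 0 = u"
| "unroll ok y u (Suc i) = (if ok i then y i \<noteq> unroll ok y u i else y i)"

definition cycle_solution ::
  "nat \<Rightarrow> (nat \<Rightarrow> bool) \<Rightarrow> (nat \<Rightarrow> bool) \<Rightarrow> bool \<Rightarrow> (nat \<Rightarrow> bool) \<Rightarrow> bool" where
  "cycle_solution L ok y b a \<longleftrightarrow>
    (\<forall>i<L. y i = (if ok i then (a i \<noteq> a (cyc_prev L i)) \<noteq> (i = 0 \<and> b) else a i))"

text \<open>The assumption closes the cycle: \<open>unroll ok y u L\<close> is the last bit, and its
  sum with \<open>b\<close> has to be the start value \<open>u\<close>.\<close>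

lemma cycle_solution_unroll:
  assumes "b = (u \<noteq> unroll ok y u L)"
  shows "cycle_solution L ok y b (\<lambda>i. unroll ok y u (Suc i))"
  unfolding cycle_solution_def
proof (intro allI impI)
  fix i assume "i < L"
  then show "y i = (if ok i then (unroll ok y u (Suc i) \<noteq> unroll ok y u (Suc (cyc_prev L i)))
      \<noteq> (i = 0 \<and> b) else unroll ok y u (Suc i))"
  proof (cases i)
    case 0
    then have "Suc (cyc_prev L i) = L" using \<open>i < L\<close> by (simp add: cyc_prev_def)
    then show ?thesis using assms 0 by auto
  next
    case (Suc j)
    then show ?thesis by (auto simp: cyc_prev_def)
  qed
qed

text \<open>The cut at \<open>j\<close> resets the bit to \<open>y j\<close>, which wipes out the
  start value.\<close>

lemma unroll_cut:
  assumes "j < k" "\<not> ok j"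
  shows "unroll ok y u k = unroll ok y u' k"
  using assms by (induction k) (auto simp: less_Suc_eq)

text \<open>The last bit does not depend on \<open>u\<close>, so \<open>u\<close> can be chosen to
  close the cycle for any given \<open>b\<close>.\<close>

lemma cycle_solution_cut:
  assumes "\<exists>i<L. \<not> ok i"
  shows "\<exists>a. cycle_solution L ok y b a"
proof -
  obtain j where "j < L" "\<not> ok j" using assms by blast
  define u where "u = (b \<noteq> unroll ok y False L)"
  have "unroll ok y u L = unroll ok y False L"
    using unroll_cut \<open>j < L\<close> \<open>\<not> ok j\<close> by metis
  then have "b = (u \<noteq> unroll ok y u L)" by (auto simp: u_def)
  then show ?thesis using cycle_solution_unroll by blast
qed

text \<open>Here \<open>u\<close> is arbitrary and \<open>b\<close> is read off from the closing
  condition.\<close>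

lemma cycle_solution_intact: "\<exists>b a. cycle_solution L ok y b a"
  using cycle_solution_unroll by blast

text \<open>A preimage is a discrete integral of \<open>y\<close> with constant \<open>b\<close>:
  the parity of the ones of \<open>y\<close> between \<open>p\<close> and \<open>z\<close>, on
  either side of \<open>p\<close>.\<close>

lemma xor_rule_surjective:
  fixes y :: "int \<Rightarrow> bool" and p :: int and b :: bool
  shows "\<exists>B. B p = b \<and> (\<forall>z. (B z \<noteq> B (z + 1)) = y z)"
proof -
  define K where "K z = {k. y k \<and> (p \<le> k \<and> k < z \<or> z \<le> k \<and> k < p)}" for z
  define B where "B z = (b \<noteq> odd (card (K z)))" for z
  have fin: "finite (K z)" for z
    by (rule finite_subset[of _ "{p..<z} \<union> {z..<p}"]) (auto simp: K_def)
  have "(B z \<noteq> B (z + 1)) = y z" for z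
  proof (cases "y z")
    case False
    then have "K (z + 1) = K z"
      unfolding K_def by (smt (verit) Collect_cong)
    then show ?thesis using False by (simp add: B_def)
  next
    case True
    show ?thesis
    proof (cases "p \<le> z")
      case True
      then have "K (z + 1) = insert z (K z)" "z \<notin> K z"
        using \<open>y z\<close> by (auto simp: K_def)
      then show ?thesis using \<open>y z\<close> fin by (simp add: B_def)
    next
      case False
      then have "K z = insert z (K (z + 1))" "z \<notin> K (z + 1)"
        using \<open>y z\<close> by (auto simp: K_def)
      then show ?thesis using \<open>y z\<close> fin by (simp add: B_def)
    qed
  qed
  moreover have "K p = {}" by (auto simp: K_def)
  then have "B p = b" by (simp add: B_def)
  ultimately show ?thesis by blast
qed

lemma bit_update_surjective:
  assumes unique: "\<And>r. r \<noteq> 0 \<Longrightarrow> \<exists>i<L. \<tau> (r + d i) \<noteq> \<tau> (d i)"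
  shows "\<exists>c. \<forall>z. \<forall>i\<le>L. bit_update \<tau> d L c z i = y z i"
proof -
  let ?sol = "\<lambda>x. cycle_solution L (\<lambda>i. \<tau> (x + d i) = \<tau> (d i)) (\<lambda>i. y (x + d i) i)"
  \<comment> \<open>The cycle of \<open>0\<close> comes first, as it dictates the bit at
    \<open>d 0\<close>; \<open>B\<close> is fitted to it, and the cut cycles are solved for that
    \<open>B\<close>.\<close>
  obtain b0 a0 where a0: "?sol 0 b0 a0"
    using cycle_solution_intact by blast
  obtain B where B0: "B (d 0) = b0" and B: "\<And>z. (B z \<noteq> B (z + 1)) = y z L"
    using xor_rule_surjective[of "d 0" b0 "\<lambda>z. y z L"] by blast
  have "\<exists>a. ?sol x (B (x + d 0)) a" for x
  proof (cases "x = 0")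
    case True
    then show ?thesis using a0 B0 by auto
  next
    case False
    then show ?thesis using unique by (intro cycle_solution_cut) simp
  qed
  then obtain a where a: "\<And>x. ?sol x (B (x + d 0)) (a x)"
    using choice[of "\<lambda>x. ?sol x (B (x + d 0))"] by blast
  \<comment> \<open>For \<open>i < L\<close>, bit \<open>i\<close> of cell \<open>z\<close> lies on
    exactly one cycle, that of \<open>z - d i\<close>.\<close>
  define c where "c z i = (if i = L then B z else a (z - d i) i)" for z i
  have "bit_update \<tau> d L c z i = y z i" if "i \<le> L" for z i
  proof (cases "i = L")
    case True
    then show ?thesis using B by (simp add: bit_update_def cell_update_def c_def)
  next
    case False
    with that have i: "i < L" "cyc_prev L i \<noteq> L" using cyc_prev_less[of i L] by auto
    have "c (z + (d (cyc_prev L i) - d i)) (cyc_prev L i) = a (z - d i) (cyc_prev L i)"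
      using i by (simp add: c_def)
    moreover have "y z i = (if \<tau> z = \<tau> (d i)
        then (a (z - d i) i \<noteq> a (z - d i) (cyc_prev L i)) \<noteq> (i = 0 \<and> B z) else a (z - d i) i)"
      using a[of "z - d i", unfolded cycle_solution_def, rule_format, OF i(1)] by (cases "i = 0") simp_all
    ultimately show ?thesis
      using i by (simp add: bit_update_def cell_update_def c_def)
  qed
  then show ?thesis by blast
qed

text \<open>Each bit of the cycle of \<open>0\<close> flips together with its predecessor, and no
  cell \<open>d i\<close> cuts this cycle, so the changes cancel.\<close>

lemma bit_update_complemented_cycle:
  "bit_update \<tau> d L (\<lambda>z i. i < L \<and> z = d i) = bit_update \<tau> d L (\<lambda>z i. False)"
proof (intro ext)
  fix z i
  have "cyc_prev L i < L \<longleftrightarrow> i < L" if "i \<noteq> L"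
    using that by (auto simp: cyc_prev_def)
  then show "bit_update \<tau> d L (\<lambda>z i. i < L \<and> z = d i) z i = bit_update \<tau> d L (\<lambda>z i. False) z i"
    by (auto simp: bit_update_def cell_update_def)
qed

text \<open>Cutting off beyond \<open>L\<close> makes the state set \<open>range (enc L)\<close>
  finite.\<close>

definition enc :: "nat \<Rightarrow> (nat \<Rightarrow> bool) \<Rightarrow> nat" where
  "enc L P = set_encode {i. i \<le> L \<and> P i}"

definition dec :: "nat \<Rightarrow> nat \<Rightarrow> bool" where
  "dec s i \<longleftrightarrow> i \<in> set_decode s"

lemma dec_enc: "dec (enc L P) i \<longleftrightarrow> i \<le> L \<and> P i"
  by (simp add: dec_def enc_def)

lemma enc_cong: "(\<And>i. i \<le> L \<Longrightarrow> P i = Q i) \<Longrightarrow> enc L P = enc L Q"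
  unfolding enc_def by (auto intro!: arg_cong[of _ _ set_encode])

lemma finite_range_enc: "finite (range (enc L))"
proof (rule finite_subset)
  show "range (enc L) \<subseteq> set_encode ` Pow {..L}" by (auto simp: enc_def)
qed simp

lemma enc_dec: "s \<in> range (enc L) \<Longrightarrow> enc L (dec s) = s"
  by (auto simp: dec_enc intro!: enc_cong)

text \<open>Position \<open>i + 2\<close> holds the offset from \<open>x + d i\<close> to its
  predecessor on the cycle of \<open>x\<close>.\<close>

definition neighbourhood :: "(nat \<Rightarrow> int) \<Rightarrow> nat \<Rightarrow> int list" where
  "neighbourhood d L = 0 # 1 # map (\<lambda>i. d (cyc_prev L i) - d i) [0..<L]"

definition template_rule :: "(int \<Rightarrow> 't) \<Rightarrow> (nat \<Rightarrow> int) \<Rightarrow> nat \<Rightarrow> 't \<Rightarrow> nat list \<Rightarrow> nat" where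
  "template_rule \<tau> d L t =
    (\<lambda>w \<in> {w. set w \<subseteq> range (enc L) \<and> length w = length (neighbourhood d L)}.
      enc L (cell_update L (\<lambda>i. t = \<tau> (d i)) (dec (w ! 0)) (dec (w ! 1))
        (\<lambda>i. dec (w ! (i + 2)) (cyc_prev L i))))"

lemma template_rule_local:
  "template_rule \<tau> d L t \<in> local_rules (range (enc L)) (neighbourhood d L)"
  unfolding template_rule_def local_rules_def unfolding restrict_PiE_iff by simp

lemma global_template_rule:
  assumes "c \<in> configs (range (enc L))"
  shows "global_rule (neighbourhood d L) (rule_distribution \<tau> (template_rule \<tau> d L)) c z
    = enc L (bit_update \<tau> d L (\<lambda>x. dec (c x)) z)"
proof -
  have "c x \<in> range (enc L)" for x using assms by (auto simp: configs_def)
  then have "set (map (\<lambda>n. c (z + n)) (neighbourhood d L)) \<subseteq> range (enc L)" by auto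
  then show ?thesis
    unfolding global_rule_def rule_distribution_def template_rule_def bit_update_def
    by (auto simp: neighbourhood_def cell_update_def intro!: enc_cong)
qed

theorem theorem4:
  fixes T :: "'t set" and \<tau> :: "int \<Rightarrow> 't"
  assumes "finite T" and "\<tau> \<in> configs T" and "\<not> recurrent \<tau>"
  shows "\<exists>(S :: nat set) (N :: int list) (R :: (nat list \<Rightarrow> nat) set) (\<alpha> :: 't \<Rightarrow> nat list \<Rightarrow> nat).
    finite S \<and> finite R \<and> R \<subseteq> local_rules S N \<and> \<alpha> \<in> T \<rightarrow> R \<and>
    global_rule N (rule_distribution \<tau> \<alpha>) ` configs S = configs S \<and>
    \<not> pre_injective_on (configs S) (global_rule N (rule_distribution \<tau> \<alpha>))"
proof -
  obtain D where D: "finite D" "D \<noteq> {}" "\<And>r. r \<noteq> 0 \<Longrightarrow> \<exists>x\<in>D. \<tau> (x + r) \<noteq> \<tau> x"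
    using assms(3) unfolding recurrent_def by metis
  obtain ds where ds: "set ds = D" using finite_list[OF D(1)] by blast
  define d where "d i = ds ! i" for i
  define L where "L = length ds"
  \<comment> \<open>This ensures later that complementing the cycle changes some bit.\<close>
  have "L > 0" using ds D(2) by (auto simp: L_def)
  have unique: "\<exists>i<L. \<tau> (r + d i) \<noteq> \<tau> (d i)" if r: "r \<noteq> 0" for r
  proof -
    obtain x where "x \<in> D" "\<tau> (x + r) \<noteq> \<tau> x" using D(3)[OF r] by blast
    moreover obtain i where "i < L" "d i = x"
      using \<open>x \<in> D\<close> ds by (auto simp: in_set_conv_nth d_def L_def)
    ultimately show ?thesis by (auto simp: add.commute)
  qed
  define S where "S = range (enc L)"
  define H where "H = global_rule (neighbourhood d L) (rule_distribution \<tau> (template_rule \<tau> d L))"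
  have H: "H c z = enc L (bit_update \<tau> d L (\<lambda>x. dec (c x)) z)" if "c \<in> configs S" for c z
    using global_template_rule that unfolding H_def S_def by blast
  \<comment> \<open>Encoding loses the bits beyond \<open>L\<close>, but the updated bits up to
    \<open>L\<close> read only bits up to \<open>L\<close>.\<close>
  have H_enc: "H (\<lambda>z. enc L (c z)) z = enc L (bit_update \<tau> d L c z)" for c z
  proof -
    have "H (\<lambda>z. enc L (c z)) z = enc L (bit_update \<tau> d L (\<lambda>x. dec (enc L (c x))) z)"
      by (rule H) (auto simp: configs_def S_def)
    also have "\<dots> = enc L (bit_update \<tau> d L c z)"
    proof (rule enc_cong)
      fix i assume "i \<le> L"
      then show "bit_update \<tau> d L (\<lambda>x. dec (enc L (c x))) z i = bit_update \<tau> d L c z i"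
        using cyc_prev_less[of i L] by (auto simp: bit_update_def cell_update_def dec_enc)
    qed
    finally show ?thesis .
  qed
  have "H ` configs S = configs S"
  proof
    show "H ` configs S \<subseteq> configs S"
    proof
      fix e assume "e \<in> H ` configs S"
      then obtain c where "c \<in> configs S" "e = H c" by blast
      then show "e \<in> configs S" using H by (auto simp: configs_def S_def)
    qed
    show "configs S \<subseteq> H ` configs S"
    proof
      fix e assume e: "e \<in> configs S"
      obtain c where c: "\<And>z i. i \<le> L \<Longrightarrow> bit_update \<tau> d L c z i = dec (e z) i"
        using bit_update_surjective[of L \<tau> d "\<lambda>z. dec (e z)"] unique by blast
      have "H (\<lambda>z. enc L (c z)) z = e z" for z
      proof -
        have "H (\<lambda>z. enc L (c z)) z = enc L (dec (e z))"
          unfolding H_enc using c by (rule enc_cong)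
        also have "\<dots> = e z" using e by (intro enc_dec) (auto simp: configs_def S_def)
        finally show ?thesis .
      qed
      then have "H (\<lambda>z. enc L (c z)) = e" by blast
      moreover have "(\<lambda>z. enc L (c z)) \<in> configs S" by (auto simp: configs_def S_def)
      ultimately show "e \<in> H ` configs S" by blast
    qed
  qed
  moreover have "\<not> pre_injective_on (configs S) H"
  proof -
    let ?c = "\<lambda>z::int. enc L (\<lambda>i. i < L \<and> z = d i)" and ?e = "\<lambda>z::int. enc L (\<lambda>i. False)"
    have "?c \<in> configs S" "?e \<in> configs S" by (auto simp: configs_def S_def)
    moreover have "asymptotic ?c ?e"
      unfolding asymptotic_def
    proof (rule finite_subset)
      show "{z. ?c z \<noteq> ?e z} \<subseteq> d ` {..<L}"
        by (auto intro!: enc_cong)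
    qed simp
    moreover have "?c \<noteq> ?e"
    proof
      assume "?c = ?e"
      then have "dec (?c (d 0)) 0 = dec (?e (d 0)) 0" by metis
      then show False using \<open>L > 0\<close> by (simp add: dec_enc)
    qed
    moreover have "H ?c = H ?e"
      by (rule ext) (simp only: H_enc bit_update_complemented_cycle)
    ultimately show ?thesis unfolding pre_injective_on_def by blast
  qed
  moreover have "template_rule \<tau> d L ` T \<subseteq> local_rules S (neighbourhood d L)"
    by (auto simp: S_def intro: template_rule_local)
  moreover have "finite S" "finite (template_rule \<tau> d L ` T)" "template_rule \<tau> d L \<in> T \<rightarrow> template_rule \<tau> d L ` T"
    using finite_range_enc assms(1) by (auto simp: S_def)
  ultimately show ?thesis
    unfolding H_def
    by (intro exI[of _ S] exI[of _ "neighbourhood d L"] exI[of _ "template_rule \<tau> d L ` T"]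
        exI[of _ "template_rule \<tau> d L"] conjI)
qed

end
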